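(* Let $\lambda\in(0,\frac12)$ and $\gamma\in(0,1)$. Then $\alpha_2(\lambda,\gamma)\ge 2\alpha_1(\lambda,\gamma)$ if $\lambda\le\frac{2+2\sqrt2-\gamma}{8+6\sqrt2-\gamma}$, and $\alpha_2(\lambda,\gamma)\le 2\alpha_1(\lambda,\gamma)$ if $\lambda\ge\frac{2+2\sqrt2-\gamma}{8+6\sqrt2-\gamma}$.
   Context: For $\lambda\in(0,1)$ and $\gamma\in(0,1)$ with $\lambda(1+\gamma)<1$, a real polynomial $p$ is said to be $(\lambda,\gamma)$-admissible if: (i) $p(\lambda)=0$; (ii) for all $x\in[0,(1-\gamma)\lambda]$, $-1\le p(x)\le p((1-\gamma)\lambda)<0$; and (iii) for all $x\in[(1+\gamma)\lambda,1]$, $0<p((1+\gamma)\lambda)\le p(x)\le 1$. The $(\lambda,\gamma)$-admissible gap of a $(\lambda,\gamma)$-admissible polynomial $p$ is $\alpha(p;\lambda,\gamma)=\min\{-p((1-\gamma)\lambda),\,p((1+\gamma)\lambda)\}$. The optimal gap $\alpha_n(\lambda,\gamma)$ is the maximum of $\alpha(p;\lambda,\gamma)$ over all $(\lambda,\gamma)$-admissible polynomials $p$ of degree $n$. *)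

theory Defs
  imports Complex_Main "HOL-Computational_Algebra.Polynomial"
begin

text \<open>
  Throughout, the parameters are meant to satisfy \<open>0 < lam < 1\<close>, \<open>0 < \<gamma> < 1\<close> and
  \<open>lam * (1 + \<gamma>) < 1\<close>.
\<close>

definition admissible :: "real \<Rightarrow> real \<Rightarrow> real poly \<Rightarrow> bool" where
  "admissible lam \<gamma> p \<longleftrightarrow>
     poly p lam = 0 \<and>
     (\<forall>x\<in>{0..(1 - \<gamma>) * lam}.
        -1 \<le> poly p x \<and> poly p x \<le> poly p ((1 - \<gamma>) * lam) \<and> poly p ((1 - \<gamma>) * lam) < 0) \<and>
     (\<forall>x\<in>{(1 + \<gamma>) * lam..1}.
        0 < poly p ((1 + \<gamma>) * lam) \<and> poly p ((1 + \<gamma>) * lam) \<le> poly p x \<and> poly p x \<le> 1)"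

definition admissible_gap :: "real \<Rightarrow> real \<Rightarrow> real poly \<Rightarrow> real" where
  "admissible_gap lam \<gamma> p = min (- poly p ((1 - \<gamma>) * lam)) (poly p ((1 + \<gamma>) * lam))"

text \<open>
  A genuine maximum rather than a supremum: \<open>GREATEST\<close> is only specified if the maximum
  over the polynomials of degree exactly \<open>n\<close> is attained.
\<close>

definition optimal_gap :: "nat \<Rightarrow> real \<Rightarrow> real \<Rightarrow> real" where
  "optimal_gap n lam \<gamma> =
     (GREATEST a. \<exists>p. admissible lam \<gamma> p \<and> degree p = n \<and> a = admissible_gap lam \<gamma> p)"

end

theory Submission
  imports Defs
begin

text \<open>
  Write \<open>p(x) = k (x - lam) - m (x - lam)\<^sup>2\<close> and \<open>e = \<gamma> * lam\<close>. Up to the factor \<open>e\<close> the gap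
  is \<open>k - \<bar>m\<bar> e\<close>, and the conditions \<open>p(0) \<ge> -1\<close>, \<open>p(1) \<ge> p(lam + e)\<close>, \<open>p \<le> 1\<close> are linear in
  \<open>(k, m)\<close>. So we maximise the linear function \<open>k - m e\<close>, which is an upper bound whatever the
  sign of \<open>m\<close> and exact at the optimum, where \<open>m > 0\<close>. Two constraints are active there, and
  suitable nonnegative multipliers for them certify optimality.
  With \<open>r = 1 + sqrt 2\<close>, which satisfies \<open>r\<^sup>2 = 2 r + 1\<close>, there are three regimes:
  for \<open>lam * (2 * r + 1 - \<gamma>) \<le> 1\<close> the active constraints are \<open>p(1) \<ge> p(lam + e)\<close> and
  \<open>p \<le> 1\<close> at the vertex; for larger \<open>lam\<close> with \<open>lam * (r + 1) \<le> 1\<close> they are \<open>p(0) \<ge> -1\<close> and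
  \<open>p \<le> 1\<close> at the vertex; for still larger \<open>lam\<close> they are \<open>p(0) \<ge> -1\<close> and \<open>p(1) \<le> 1\<close>.
  The threshold of the theorem lies in the middle regime.
\<close>

definition feasible :: "real \<Rightarrow> real \<Rightarrow> real \<Rightarrow> real \<Rightarrow> bool" where
  "feasible lam \<gamma> k m \<longleftrightarrow>
     m * (1 - lam + \<gamma> * lam) \<le> k \<and> k * lam + m * lam\<^sup>2 \<le> 1 \<and>
     (\<forall>t\<in>{\<gamma> * lam..1 - lam}. k * t - m * t\<^sup>2 \<le> 1)"

lemma optimal_gap_eqI:
  assumes "admissible lam \<gamma> p" "degree p = n"
    and "\<And>q. admissible lam \<gamma> q \<Longrightarrow> degree q = n \<Longrightarrow> admissible_gap lam \<gamma> q \<le> admissible_gap lam \<gamma> p"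
  shows "optimal_gap n lam \<gamma> = admissible_gap lam \<gamma> p"
  unfolding optimal_gap_def using assms by (intro Greatest_equality) auto

lemma poly_degree_le_2:
  fixes p :: "real poly"
  assumes "degree p \<le> 2"
  shows "poly p x = coeff p 0 + coeff p 1 * x + coeff p 2 * x\<^sup>2"
proof -
  have "poly p x = (\<Sum>i\<le>2. coeff p i * x ^ i)"
    using assms by (subst poly_altdef) (intro sum.mono_neutral_left, auto simp: coeff_eq_0)
  then show ?thesis
    by (simp add: numeral_2_eq_2)
qed

section \<open>Parameters with \<open>lam < 1 / 2\<close>, and the optimal gap in degree one\<close>

context
  fixes lam \<gamma> :: real
  assumes lam: "0 < lam" "lam < 1 / 2" and \<gamma>: "0 < \<gamma>" "\<gamma> < 1"
begin

lemma gamma_lam: "0 < \<gamma> * lam" "\<gamma> * lam < lam" "\<gamma> * lam < 1 - lam"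
proof -
  show "0 < \<gamma> * lam" "\<gamma> * lam < lam" using lam \<gamma> by auto
  then show "\<gamma> * lam < 1 - lam" using lam by linarith
qed

text \<open>A line vanishing at \<open>lam\<close> is determined by its slope, and
  \<open>p(1) \<le> 1\<close> caps the slope at \<open>1 / (1 - lam)\<close>. The extremal line
  respects \<open>p(0) \<ge> -1\<close> because \<open>lam < 1 / 2\<close>.\<close>

lemma optimal_gap_1: "optimal_gap 1 lam \<gamma> = \<gamma> * lam * (1 / (1 - lam))"
proof -
  define p where "p = [:- lam / (1 - lam), 1 / (1 - lam):]"
  have px: "poly p x = (x - lam) / (1 - lam)" for x
    by (simp add: p_def diff_divide_distrib)
  have deg: "degree p = 1"
    using lam by (simp add: p_def)
  have adm: "admissible lam \<gamma> p"
  proof -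
    have mono: "poly p x \<le> poly p y" if "x \<le> y" for x y
      unfolding px using that lam by (intro divide_right_mono) auto
    have "- 1 \<le> poly p 0" "poly p 1 = 1"
      using lam by (simp_all add: px divide_simps)
    then have "- 1 \<le> poly p x" if "0 \<le> x" for x
      using mono[OF that] by simp
    moreover have "poly p x \<le> 1" if "x \<le> 1" for x
      using mono[OF that] \<open>poly p 1 = 1\<close> by simp
    moreover have "poly p ((1 - \<gamma>) * lam) < 0" "0 < poly p ((1 + \<gamma>) * lam)"
      unfolding px using lam gamma_lam by (simp_all add: divide_simps algebra_simps)
    ultimately show ?thesis
      unfolding admissible_def using mono by (auto simp: px)
  qed
  have gap: "admissible_gap lam \<gamma> p = \<gamma> * lam * (1 / (1 - lam))"
    unfolding admissible_gap_def px by (simp add: divide_simps algebra_simps)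
  have "admissible_gap lam \<gamma> q \<le> admissible_gap lam \<gamma> p"
    if "admissible lam \<gamma> q" "degree q = 1" for q
  proof -
    define c where "c = coeff q 1"
    have "poly q x = coeff q 0 + c * x" for x
      using poly_degree_le_2[of q x] that(2) by (simp add: c_def coeff_eq_0)
    moreover have "poly q lam = 0"
      using that(1) by (simp add: admissible_def)
    ultimately have qx: "poly q x = c * (x - lam)" for x
      by (simp add: algebra_simps eq_neg_iff_add_eq_0)
    have "poly q 1 \<le> 1"
      using that(1) gamma_lam by (auto simp: admissible_def algebra_simps)
    then have c: "c \<le> 1 / (1 - lam)"
      using lam by (simp add: qx pos_le_divide_eq)
    have "admissible_gap lam \<gamma> q \<le> \<gamma> * lam * c"
      by (simp add: admissible_gap_def qx algebra_simps)
    also have "\<dots> \<le> \<gamma> * lam * (1 / (1 - lam))"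
      using c gamma_lam by (intro mult_left_mono) auto
    finally show ?thesis
      by (simp add: gap)
  qed
  then show ?thesis
    using optimal_gap_eqI[OF adm deg] gap by simp
qed

section \<open>Degree two as a linear programme in \<open>(k, m)\<close>\<close>

text \<open>For \<open>m > 0\<close> the parabola is concave, so the value at \<open>lam + e\<close>
  is the smaller of the two sides of the gap. Monotonicity on the left and a factorisation on the
  right reduce admissibility to the constraints in \<open>feasible\<close>.\<close>

lemma feasible_imp_admissible:
  assumes "feasible lam \<gamma> k m" "0 < m"
  obtains p where "admissible lam \<gamma> p" "degree p = 2"
    "admissible_gap lam \<gamma> p = \<gamma> * lam * (k - m * (\<gamma> * lam))"
proof
  define p where "p = [:- k * lam - m * lam\<^sup>2, k + 2 * m * lam, - m:]"
  define e where "e = \<gamma> * lam"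
  note e = gamma_lam[folded e_def]
  have px: "poly p x = k * (x - lam) - m * (x - lam)\<^sup>2" for x
    by (simp add: p_def algebra_simps power2_eq_square)
  show "degree p = 2"
    using assms by (simp add: p_def)
  have k: "m * (1 - lam + e) \<le> k" and p0: "k * lam + m * lam\<^sup>2 \<le> 1"
    and le1: "\<And>t. e \<le> t \<Longrightarrow> t \<le> 1 - lam \<Longrightarrow> k * t - m * t\<^sup>2 \<le> 1"
    using assms(1) by (auto simp: feasible_def e_def)
  have k_ge: "m * u \<le> k" if "u \<le> 1 - lam + e" for u
    using mult_left_mono[OF that, of m] k assms(2) by linarith
  have kme: "m * e < k"
  proof -
    have "m * e < m * (1 - lam + e)"
      using assms(2) lam by (intro mult_strict_left_mono) auto
    then show ?thesis using k by linarith
  qed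
  have k_pos: "0 < k"
    using kme mult_pos_pos[OF assms(2) e(1)] by linarith
  have pa: "poly p ((1 - \<gamma>) * lam) = - (e * (k + m * e))"
    and pb: "poly p ((1 + \<gamma>) * lam) = e * (k - m * e)"
    by (simp_all add: px e_def algebra_simps power2_eq_square)
  have pa_neg: "poly p ((1 - \<gamma>) * lam) < 0"
    unfolding pa using e k_pos assms(2) by (simp add: add_pos_pos)
  have pb_pos: "0 < poly p ((1 + \<gamma>) * lam)"
    unfolding pb using e kme by simp
  show "admissible_gap lam \<gamma> p = \<gamma> * lam * (k - m * (\<gamma> * lam))"
  proof -
    have "e * (k - m * e) \<le> e * (k + m * e)"
      using e assms(2) by (intro mult_left_mono) auto
    then show ?thesis
      unfolding admissible_gap_def pa pb by (simp add: min_def e_def)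
  qed
  show "admissible lam \<gamma> p"
    unfolding admissible_def
  proof (intro conjI ballI pa_neg pb_pos)
    show "poly p lam = 0" by (simp add: px)
  next
    fix x assume x: "x \<in> {0..(1 - \<gamma>) * lam}"
    define t where "t = lam - x"
    have t: "e \<le> t" "t \<le> lam"
      using x by (auto simp: t_def e_def algebra_simps)
    have pt: "poly p x = - (k * t + m * t\<^sup>2)"
      by (simp add: px t_def algebra_simps power2_eq_square)
    \<comment> \<open>As \<open>k\<close> and \<open>m\<close> are positive,
      \<open>k * t + m * t^2\<close> increases for \<open>t \<ge> 0\<close>, so only the endpoints
      \<open>t = lam\<close> and \<open>t = e\<close> matter.\<close>
    have "k * t + m * t\<^sup>2 \<le> k * lam + m * lam\<^sup>2"
      using t e k_pos assms(2) by (intro add_mono mult_left_mono power_mono) auto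
    then show "- 1 \<le> poly p x"
      using p0 pt by linarith
    have "k * e + m * e\<^sup>2 \<le> k * t + m * t\<^sup>2"
      using t e k_pos assms(2) by (intro add_mono mult_left_mono power_mono) auto
    then show "poly p x \<le> poly p ((1 - \<gamma>) * lam)"
      unfolding pt pa by (simp add: algebra_simps power2_eq_square)
  next
    fix x assume x: "x \<in> {(1 + \<gamma>) * lam..1}"
    define t where "t = x - lam"
    have t: "e \<le> t" "t \<le> 1 - lam"
      using x by (auto simp: t_def e_def algebra_simps)
    have pt: "poly p x = k * t - m * t\<^sup>2"
      by (simp add: px t_def)
    show "poly p x \<le> 1"
      using le1[OF t] pt by simp
    \<comment> \<open>This product is \<open>p(lam + t) - p(lam + e)\<close>.\<close>
    have "0 \<le> (t - e) * (k - m * (t + e))"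
      using t k_ge[of "t + e"] by simp
    then show "poly p ((1 + \<gamma>) * lam) \<le> poly p x"
      unfolding pt pb by (simp add: algebra_simps power2_eq_square)
  qed
qed

text \<open>The sign of \<open>m\<close> is left open: the gap, being a minimum, is at most its
  right-hand side \<open>p(lam + e) = e * (k - m * e)\<close>.\<close>

lemma admissible_imp_feasible:
  assumes "admissible lam \<gamma> p" "degree p = 2"
  obtains k m where "feasible lam \<gamma> k m"
    "admissible_gap lam \<gamma> p \<le> \<gamma> * lam * (k - m * (\<gamma> * lam))"
proof
  \<comment> \<open>Taylor coefficients at the root: \<open>k = p'(lam)\<close> and
    \<open>m = - p''(lam) / 2\<close>.\<close>
  define m where "m = - coeff p 2"
  define k where "k = coeff p 1 + 2 * coeff p 2 * lam"
  have p: "poly p x = coeff p 0 + coeff p 1 * x + coeff p 2 * x\<^sup>2" for x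
    using poly_degree_le_2 assms(2) by simp
  have p_lam: "coeff p 0 = - coeff p 1 * lam - coeff p 2 * lam\<^sup>2"
    using p[of lam] assms(1) by (simp add: admissible_def)
  have px: "poly p x = k * (x - lam) - m * (x - lam)\<^sup>2" for x
    unfolding p p_lam by (simp add: k_def m_def algebra_simps power2_eq_square)
  have b: "(1 + \<gamma>) * lam = lam + \<gamma> * lam"
    by (simp add: algebra_simps)
  have p0: "- 1 \<le> poly p 0"
    using assms(1) lam \<gamma> by (auto simp: admissible_def)
  have le1: "k * t - m * t\<^sup>2 \<le> 1" if "t \<in> {\<gamma> * lam..1 - lam}" for t
  proof -
    have "poly p (lam + t) \<le> 1"
      using assms(1) that by (auto simp: admissible_def b)
    then show ?thesis by (simp add: px)
  qed
  have "poly p (lam + \<gamma> * lam) \<le> poly p 1"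
    using assms(1) gamma_lam by (auto simp: admissible_def b)
  \<comment> \<open>This product is \<open>p(1) - p(lam + e)\<close>; its first factor is
    positive.\<close>
  then have "0 \<le> (1 - lam - \<gamma> * lam) * (k - m * (1 - lam + \<gamma> * lam))"
    by (simp add: px algebra_simps power2_eq_square)
  then have "m * (1 - lam + \<gamma> * lam) \<le> k"
    using gamma_lam by (simp add: zero_le_mult_iff)
  then show "feasible lam \<gamma> k m"
    using le1 p0 by (simp add: feasible_def px algebra_simps)
  show "admissible_gap lam \<gamma> p \<le> \<gamma> * lam * (k - m * (\<gamma> * lam))"
    by (simp add: admissible_gap_def b px algebra_simps power2_eq_square)
qed

lemma optimal_gap_2_eqI:
  assumes "feasible lam \<gamma> k m" "0 < m"
    and opt: "\<And>k' m'. feasible lam \<gamma> k' m' \<Longrightarrow> k' - m' * (\<gamma> * lam) \<le> k - m * (\<gamma> * lam)"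
  shows "optimal_gap 2 lam \<gamma> = \<gamma> * lam * (k - m * (\<gamma> * lam))"
proof -
  obtain p where p: "admissible lam \<gamma> p" "degree p = 2"
    "admissible_gap lam \<gamma> p = \<gamma> * lam * (k - m * (\<gamma> * lam))"
    using feasible_imp_admissible assms(1,2) by blast
  have "admissible_gap lam \<gamma> q \<le> admissible_gap lam \<gamma> p"
    if q: "admissible lam \<gamma> q" "degree q = 2" for q
  proof -
    obtain k' m' where km: "feasible lam \<gamma> k' m'"
      "admissible_gap lam \<gamma> q \<le> \<gamma> * lam * (k' - m' * (\<gamma> * lam))"
      using admissible_imp_feasible q by blast
    have "\<gamma> * lam * (k' - m' * (\<gamma> * lam)) \<le> \<gamma> * lam * (k - m * (\<gamma> * lam))"
      using opt[OF km(1)] gamma_lam by (intro mult_left_mono) auto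
    then show ?thesis using km(2) p(3) by linarith
  qed
  then show ?thesis
    using optimal_gap_eqI[OF p(1,2)] p(3) by simp
qed

section \<open>Optimal quadratics in the three regimes\<close>

text \<open>Equality \<open>p(1) = p(lam + e)\<close> puts the vertex at \<open>t = s / 2\<close>,
  midway between \<open>e\<close> and \<open>1 - lam\<close>; vertex value 1 then gives
  \<open>k = 4 / s\<close>, \<open>m = 4 / s^2\<close>.\<close>

lemma optimal_gap_2_small:
  fixes r :: real
  assumes r: "r\<^sup>2 = 2 * r + 1" "2 < r" and small: "lam * (2 * r + 1 - \<gamma>) \<le> 1"
  shows "optimal_gap 2 lam \<gamma> = \<gamma> * lam * (4 * (1 - lam) / (1 - lam + \<gamma> * lam)\<^sup>2)"
proof -
  define s where "s = 1 - lam + \<gamma> * lam"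
  define e where "e = \<gamma> * lam"
  note e = gamma_lam[folded e_def]
  have s: "0 < s" using e lam by (simp add: s_def e_def[symmetric])
  have se: "s = 1 - lam + e" by (simp add: s_def e_def)
  have "feasible lam \<gamma> (4 / s) (4 / s\<^sup>2)"
    unfolding feasible_def s_def[symmetric]
  proof (intro conjI ballI)
    show "4 / s\<^sup>2 * s \<le> 4 / s"
      using s by (simp add: power2_eq_square)
    \<comment> \<open>With \<open>u = 2 * lam / s\<close>, the goal \<open>p(0) \<ge> -1\<close>
      reads \<open>u^2 + 2 * u \<le> 1\<close>, whose positive root is \<open>1 / r\<close>.\<close>
    have rl: "2 * r * lam \<le> s"
      using small by (simp add: s_def algebra_simps)
    have "2 * lam \<le> r * lam"
      using r lam by (intro mult_right_mono) auto
    then have "0 \<le> (s - 2 * r * lam) * (s + 2 * r * lam - 4 * lam)"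
      using rl s by (intro mult_nonneg_nonneg) auto
    also have "\<dots> = s\<^sup>2 - 4 * lam * s - 4 * lam\<^sup>2 * (r\<^sup>2 - 2 * r)"
      by (simp add: algebra_simps power2_eq_square)
    finally have "4 * lam * s + 4 * lam\<^sup>2 \<le> s\<^sup>2"
      using r by simp
    then show "4 / s * lam + 4 / s\<^sup>2 * lam\<^sup>2 \<le> 1"
      using s by (simp add: divide_simps power2_eq_square algebra_simps)
  next
    fix t
    have "1 - (4 / s * t - 4 / s\<^sup>2 * t\<^sup>2) = (1 - 2 * t / s)\<^sup>2"
      using s by (simp add: field_simps power2_eq_square)
    then show "4 / s * t - 4 / s\<^sup>2 * t\<^sup>2 \<le> 1"
      by (smt (verit) zero_le_power2)
  qed
  moreover have eq: "4 / s - 4 / s\<^sup>2 * (\<gamma> * lam) = 4 * (1 - lam) / s\<^sup>2"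
    using s by (simp add: divide_simps power2_eq_square) (simp add: s_def algebra_simps)
  moreover have "k - m * (\<gamma> * lam) \<le> 4 / s - 4 / s\<^sup>2 * (\<gamma> * lam)"
    if "feasible lam \<gamma> k m" for k m
  proof -
    have "s / 2 \<in> {e..1 - lam}"
      using e by (auto simp: se)
    then have "m * s \<le> k" and "k * (s / 2) - m * (s / 2)\<^sup>2 \<le> 1"
      using that unfolding feasible_def e_def[symmetric] se by blast+
    \<comment> \<open>The multipliers make the left side equal \<open>s^2 * (k - m * e)\<close>.
      They are nonnegative since \<open>s - e = 1 - lam\<close> and
      \<open>s - 2 * e = 1 - lam - e\<close>.\<close>
    then have "4 * (s - e) * (k * (s / 2) - m * (s / 2)\<^sup>2) + s * (s - 2 * e) * (m * s - k)
        \<le> 4 * (s - e) * 1 + s * (s - 2 * e) * 0"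
      using e s lam by (intro add_mono mult_left_mono) (auto simp: se)
    then have "s\<^sup>2 * (k - m * e) \<le> 4 * (s - e)"
      by (simp add: algebra_simps power2_eq_square)
    then show ?thesis
      unfolding eq using s by (simp add: pos_le_divide_eq se e_def mult.commute)
  qed
  ultimately show ?thesis
    using optimal_gap_2_eqI[of "4 / s" "4 / s\<^sup>2"] s by (simp add: s_def)
qed

text \<open>The optimum is \<open>1 - (1 - t / (r * lam))^2\<close> with \<open>t = x - lam\<close>;
  its value -1 at \<open>x = 0\<close> is the equation for \<open>r\<close>. \<open>lower\<close>
  expresses \<open>p(1) \<ge> p(lam + e)\<close>, and \<open>upper\<close> places the vertex
  \<open>t = r * lam\<close> inside the interval.\<close>

lemma optimal_gap_2_middle:
  fixes r :: real
  assumes r: "r\<^sup>2 = 2 * r + 1" "1 < r"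
    and lower: "1 \<le> lam * (2 * r + 1 - \<gamma>)" and upper: "lam * (r + 1) \<le> 1"
  shows "optimal_gap 2 lam \<gamma> = \<gamma> * lam * ((2 * r - \<gamma>) / (r\<^sup>2 * lam))"
proof -
  let ?k = "2 / (r * lam)" and ?m = "1 / (r * lam)\<^sup>2"
  have pos: "0 < r * lam" using r lam by simp
  have "feasible lam \<gamma> ?k ?m"
    unfolding feasible_def
  proof (intro conjI ballI)
    have "1 - lam + \<gamma> * lam \<le> 2 * (r * lam)"
      using lower by (simp add: algebra_simps)
    then have "1 / (r * lam)\<^sup>2 * (1 - lam + \<gamma> * lam) \<le> 1 / (r * lam)\<^sup>2 * (2 * (r * lam))"
      by (intro mult_left_mono) auto
    also have "\<dots> = ?k" using pos by (simp add: power2_eq_square)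
    finally show "?m * (1 - lam + \<gamma> * lam) \<le> ?k" .
    have "?k * lam + ?m * lam\<^sup>2 = (2 * r + 1) / r\<^sup>2"
      using lam r(2) by (simp add: field_simps power2_eq_square)
    then show "?k * lam + ?m * lam\<^sup>2 \<le> 1"
      using r by simp
  next
    fix t
    have "1 - (?k * t - ?m * t\<^sup>2) = (1 - t / (r * lam))\<^sup>2"
      using lam r(2) by (simp add: field_simps power2_eq_square)
    then show "?k * t - ?m * t\<^sup>2 \<le> 1"
      by (smt (verit) zero_le_power2)
  qed
  moreover have eq: "?k - ?m * (\<gamma> * lam) = (2 * r - \<gamma>) / (r\<^sup>2 * lam)"
    using lam r(2) by (simp add: field_simps power2_eq_square)
  moreover have "k - m * (\<gamma> * lam) \<le> ?k - ?m * (\<gamma> * lam)" if "feasible lam \<gamma> k m" for k m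
  proof -
    have "\<gamma> * lam \<le> r * lam"
      using \<gamma> r lam by (intro mult_right_mono) auto
    moreover have "r * lam \<le> 1 - lam"
      using upper by (simp add: algebra_simps)
    ultimately have "k * (r * lam) - m * (r * lam)\<^sup>2 \<le> 1" "k * lam + m * lam\<^sup>2 \<le> 1"
      using that by (auto simp: feasible_def)
    \<comment> \<open>Up to scaling these are the Lagrange weights expressing
      \<open>p(lam + e)\<close> through \<open>p((r + 1) * lam)\<close> and \<open>- p(0)\<close>,
      given the root at \<open>lam\<close>.\<close>
    then have "(1 + \<gamma>) * (k * (r * lam) - m * (r * lam)\<^sup>2) + r * (r - \<gamma>) * (k * lam + m * lam\<^sup>2)
        \<le> (1 + \<gamma>) * 1 + r * (r - \<gamma>) * 1"
      using \<gamma> r by (intro add_mono mult_left_mono) auto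
    then have "(r + 1) * (r * lam * (k - m * (\<gamma> * lam))) \<le> 1 + \<gamma> + r * (r - \<gamma>)"
      by (simp add: algebra_simps power2_eq_square)
    \<comment> \<open>After multiplication by \<open>r\<close>, the equation for \<open>r\<close>
      lets a factor \<open>r + 1\<close> split off on the right and cancel.\<close>
    then have "r * ((r + 1) * (r * lam * (k - m * (\<gamma> * lam)))) \<le> r * (1 + \<gamma> + r * (r - \<gamma>))"
      using r by (intro mult_left_mono) auto
    also have "\<dots> = r + r * \<gamma> + r * r\<^sup>2 - r\<^sup>2 * \<gamma>"
      by (simp add: algebra_simps power2_eq_square)
    also have "\<dots> = 2 * r\<^sup>2 + 2 * r - r * \<gamma> - \<gamma>"
    proof -
      have "r * r\<^sup>2 = 2 * r\<^sup>2 + r"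
        by (subst r(1)) (simp add: algebra_simps power2_eq_square)
      then show ?thesis
        by (simp add: r(1) algebra_simps)
    qed
    also have "\<dots> = (r + 1) * (2 * r - \<gamma>)"
      by (simp add: algebra_simps power2_eq_square)
    finally have "(r + 1) * (r\<^sup>2 * lam * (k - m * (\<gamma> * lam))) \<le> (r + 1) * (2 * r - \<gamma>)"
      by (simp add: algebra_simps power2_eq_square)
    then have "r\<^sup>2 * lam * (k - m * (\<gamma> * lam)) \<le> 2 * r - \<gamma>"
      using r by simp
    then show ?thesis
      unfolding eq using lam r(2) by (simp add: pos_le_divide_eq mult.commute)
  qed
  ultimately show ?thesis
    using optimal_gap_2_eqI[of ?k ?m] pos by (simp only: zero_less_power zero_less_divide_1_iff)
qed

text \<open>The optimum interpolates -1, 0, 1 at 0, \<open>lam\<close>, 1. The hypothesis is exactly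
  \<open>p'(1) \<ge> 0\<close> for this parabola, so it increases up to 1 and stays at most
  1.\<close>

lemma optimal_gap_2_large:
  assumes large: "2 * lam\<^sup>2 - 4 * lam + 1 \<le> 0"
  shows "optimal_gap 2 lam \<gamma> =
    \<gamma> * lam * ((1 - 2 * lam + 2 * lam\<^sup>2 - (1 - 2 * lam) * (\<gamma> * lam)) / (lam * (1 - lam)))"
proof -
  define d where "d = lam * (1 - lam)"
  define e where "e = \<gamma> * lam"
  note e = gamma_lam[folded e_def]
  have d: "0 < d" using lam by (simp add: d_def)
  let ?k = "(1 - 2 * lam + 2 * lam\<^sup>2) / d" and ?m = "(1 - 2 * lam) / d"
  have m: "0 < ?m" using d lam by simp
  have k2m: "2 * ?m * (1 - lam) \<le> ?k"
  proof -
    have "2 * ?m * (1 - lam) = 2 * (1 - 2 * lam) * (1 - lam) / d" by simp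
    also have "\<dots> \<le> ?k"
      using large d by (intro divide_right_mono) (auto simp: algebra_simps power2_eq_square)
    finally show ?thesis .
  qed
  have p1: "?k * (1 - lam) - ?m * (1 - lam)\<^sup>2 = 1"
    using d by (simp add: field_simps) (simp add: d_def algebra_simps power2_eq_square)
  have "feasible lam \<gamma> ?k ?m"
    unfolding feasible_def e_def[symmetric]
  proof (intro conjI ballI)
    have "?m * (1 - lam + e) \<le> ?m * (2 * (1 - lam))"
      using m e by (intro mult_left_mono) auto
    also have "\<dots> = 2 * ?m * (1 - lam)" by (simp only: mult_ac)
    also note k2m
    finally show "?m * (1 - lam + e) \<le> ?k" .
    have "?k * lam + ?m * lam\<^sup>2 = 1"
      using d by (simp add: field_simps) (simp add: d_def algebra_simps power2_eq_square)
    then show "?k * lam + ?m * lam\<^sup>2 \<le> 1" by simp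
  next
    fix t assume t: "t \<in> {e..1 - lam}"
    have "?m * (1 - lam + t) \<le> ?m * (2 * (1 - lam))"
      using m t by (intro mult_left_mono) auto
    also have "\<dots> = 2 * ?m * (1 - lam)" by (simp only: mult_ac)
    also note k2m
    \<comment> \<open>This product is \<open>p(1) - p(lam + t)\<close>.\<close>
    finally have "0 \<le> (1 - lam - t) * (?k - ?m * (1 - lam + t))"
      using t by (intro mult_nonneg_nonneg) simp_all
    also have "\<dots> = ?k * (1 - lam) - ?m * (1 - lam)\<^sup>2 - (?k * t - ?m * t\<^sup>2)"
      by (simp only: algebra_simps power2_eq_square)
    finally show "?k * t - ?m * t\<^sup>2 \<le> 1" using p1 by linarith
  qed
  moreover have eq: "?k - ?m * e = (1 - 2 * lam + 2 * lam\<^sup>2 - (1 - 2 * lam) * e) / d"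
    using d by (simp add: field_simps)
  moreover have "k - m * e \<le> ?k - ?m * e" if "feasible lam \<gamma> k m" for k m
  proof -
    have "k * (1 - lam) - m * (1 - lam)\<^sup>2 \<le> 1" "k * lam + m * lam\<^sup>2 \<le> 1"
      using that e by (auto simp: feasible_def e_def)
    \<comment> \<open>Scaled Lagrange weights again, now for the nodes 0, \<open>lam\<close>, 1
      evaluated at \<open>lam + e\<close>.\<close>
    then have "(lam + e) * lam * (k * (1 - lam) - m * (1 - lam)\<^sup>2)
        + (1 - lam - e) * (1 - lam) * (k * lam + m * lam\<^sup>2)
        \<le> (lam + e) * lam * 1 + (1 - lam - e) * (1 - lam) * 1"
      using e lam by (intro add_mono mult_left_mono) auto
    then have "d * (k - m * e) \<le> 1 - 2 * lam + 2 * lam\<^sup>2 - (1 - 2 * lam) * e"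
      by (simp add: d_def algebra_simps power2_eq_square)
    then show ?thesis
      unfolding eq using d by (simp add: pos_le_divide_eq mult.commute)
  qed
  ultimately show ?thesis
    using optimal_gap_2_eqI[of ?k ?m] m by (simp add: d_def e_def)
qed

section \<open>Comparison with twice the degree-one gap\<close>

lemma optimal_gap_2_vs_1:
  assumes "optimal_gap 2 lam \<gamma> = \<gamma> * lam * v"
  shows "2 * optimal_gap 1 lam \<gamma> \<le> optimal_gap 2 lam \<gamma> \<longleftrightarrow> 2 / (1 - lam) \<le> v"
    and "optimal_gap 2 lam \<gamma> \<le> 2 * optimal_gap 1 lam \<gamma> \<longleftrightarrow> v \<le> 2 / (1 - lam)"
proof -
  have "2 * optimal_gap 1 lam \<gamma> = \<gamma> * lam * (2 / (1 - lam))"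
    by (simp only: optimal_gap_1) simp
  then show "2 * optimal_gap 1 lam \<gamma> \<le> optimal_gap 2 lam \<gamma> \<longleftrightarrow> 2 / (1 - lam) \<le> v"
    and "optimal_gap 2 lam \<gamma> \<le> 2 * optimal_gap 1 lam \<gamma> \<longleftrightarrow> v \<le> 2 / (1 - lam)"
    unfolding assms using gamma_lam(1) by (simp_all only: mult_le_cancel_left_pos)
qed

text \<open>The source of the threshold: after replacing \<open>r^2\<close> by
  \<open>2 * r + 1\<close>, cross-multiplication leaves an inequality linear in
  \<open>lam\<close>.\<close>

lemma middle_value_vs_threshold:
  fixes r :: real
  assumes r: "r\<^sup>2 = 2 * r + 1" "1 < r"
  shows "2 / (1 - lam) \<le> (2 * r - \<gamma>) / (r\<^sup>2 * lam) \<longleftrightarrow> lam * (6 * r + 2 - \<gamma>) \<le> 2 * r - \<gamma>"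
    and "(2 * r - \<gamma>) / (r\<^sup>2 * lam) \<le> 2 / (1 - lam) \<longleftrightarrow> 2 * r - \<gamma> \<le> lam * (6 * r + 2 - \<gamma>)"
proof -
  have pos: "0 < 1 - lam" "0 < (2 * r + 1) * lam" using lam r by auto
  show "2 / (1 - lam) \<le> (2 * r - \<gamma>) / (r\<^sup>2 * lam) \<longleftrightarrow> lam * (6 * r + 2 - \<gamma>) \<le> 2 * r - \<gamma>"
    unfolding r(1) pos_le_divide_eq[OF pos(2)] using pos(1)
    by (simp add: divide_simps) (simp add: algebra_simps)
  show "(2 * r - \<gamma>) / (r\<^sup>2 * lam) \<le> 2 / (1 - lam) \<longleftrightarrow> 2 * r - \<gamma> \<le> lam * (6 * r + 2 - \<gamma>)"
    unfolding r(1) pos_divide_le_eq[OF pos(2)] using pos(1)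
    by (simp add: divide_simps) (simp add: algebra_simps)
qed

end

theorem proposition4:
  fixes lam \<gamma> :: real
  assumes "0 < lam" and "lam < 1 / 2" and "0 < \<gamma>" and "\<gamma> < 1"
  shows "(lam \<le> (2 + 2 * sqrt 2 - \<gamma>) / (8 + 6 * sqrt 2 - \<gamma>) \<longrightarrow>
            optimal_gap 2 lam \<gamma> \<ge> 2 * optimal_gap 1 lam \<gamma>) \<and>
         (lam \<ge> (2 + 2 * sqrt 2 - \<gamma>) / (8 + 6 * sqrt 2 - \<gamma>) \<longrightarrow>
            optimal_gap 2 lam \<gamma> \<le> 2 * optimal_gap 1 lam \<gamma>)"
proof -
  define r where "r = 1 + sqrt 2"
  have r2: "r\<^sup>2 = 2 * r + 1"
    by (simp add: r_def power2_eq_square algebra_simps)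
  have r1: "2 < r" by (simp add: r_def)
  have T: "(2 + 2 * sqrt 2 - \<gamma>) / (8 + 6 * sqrt 2 - \<gamma>) = (2 * r - \<gamma>) / (6 * r + 2 - \<gamma>)"
    by (simp add: r_def)
  have den: "0 < 6 * r + 2 - \<gamma>" using r1 assms by simp
  note lam\<gamma> = assms
  let ?T = "2 * r - \<gamma>" and ?L = "lam * (6 * r + 2 - \<gamma>)"
  have part1: "2 * optimal_gap 1 lam \<gamma> \<le> optimal_gap 2 lam \<gamma>" if le: "?L \<le> ?T"
  proof (cases "lam * (2 * r + 1 - \<gamma>) \<le> 1")
    case True
    define s where "s = 1 - lam + \<gamma> * lam"
    have s: "0 < s" unfolding s_def using gamma_lam(1)[OF lam\<gamma>] assms by linarith
    \<comment> \<open>The comparison amounts to \<open>s \<le> sqrt 2 * (1 - lam)\<close>, that is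
      \<open>\<gamma> * lam \<le> (r - 2) * (1 - lam)\<close>. Since \<open>r * (r - 2) = 1\<close>,
      the bound \<open>lam \<le> 1 / (2 * r)\<close> is
      \<open>lam \<le> (r - 2) / 2\<close>.\<close>
    have "lam * (2 * r) \<le> lam * (2 * r + 1 - \<gamma>)"
      using assms by (intro mult_left_mono) auto
    then have "2 * r * lam \<le> 1" using True by (simp add: mult.commute)
    moreover have "(r - 2) * (r * lam) \<le> (r - 2) * (1 / 2)"
      using r1 calculation by (intro mult_left_mono) auto
    moreover have "(r - 2) * (r * lam) = lam"
      using r2 by (simp add: algebra_simps power2_eq_square)
    ultimately have lam2: "lam \<le> (r - 2) * (1 / 2)" by simp
    have "(r - 2) * (1 / 2) \<le> (r - 2) * (1 - lam)"
      using r1 assms by (intro mult_left_mono) auto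
    then have "\<gamma> * lam \<le> (r - 2) * (1 - lam)"
      using lam2 gamma_lam(2)[OF lam\<gamma>] by linarith
    then have "s \<le> (r - 1) * (1 - lam)"
      by (simp add: s_def algebra_simps)
    then have "s\<^sup>2 \<le> ((r - 1) * (1 - lam))\<^sup>2"
      using s by (intro power_mono) auto
    also have "\<dots> = 2 * (1 - lam)\<^sup>2"
      by (simp add: r_def power_mult_distrib)
    finally have "2 / (1 - lam) \<le> 4 * (1 - lam) / s\<^sup>2"
      using s assms by (simp add: divide_simps power2_eq_square algebra_simps)
    then show ?thesis
      using optimal_gap_2_vs_1(1)[OF lam\<gamma> optimal_gap_2_small[OF lam\<gamma> r2 _ True]] r1
      by (simp add: s_def)
  next
    case False
    \<comment> \<open>The threshold is at most \<open>1 / (r + 1)\<close>, which excludes the third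
      regime.\<close>
    have "?L * (r + 1) \<le> ?T * (r + 1)"
      using le r1 by (intro mult_right_mono) auto
    also have "\<dots> = 2 * r\<^sup>2 + 2 * r - \<gamma> * r - \<gamma>"
      by (simp add: algebra_simps power2_eq_square)
    also have "\<dots> \<le> 6 * r + 2 - \<gamma>"
      using r1 assms by (simp add: r2)
    finally have "(6 * r + 2 - \<gamma>) * (lam * (r + 1)) \<le> (6 * r + 2 - \<gamma>) * 1"
      by (simp only: mult_ac mult_1_right mult_1)
    then have "lam * (r + 1) \<le> 1"
      using den by (simp only: mult_le_cancel_left_pos)
    then have gap: "optimal_gap 2 lam \<gamma> = \<gamma> * lam * (?T / (r\<^sup>2 * lam))"
      using optimal_gap_2_middle[OF lam\<gamma> r2] False r1 by simp
    show ?thesis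
      unfolding optimal_gap_2_vs_1(1)[OF lam\<gamma> gap]
      using middle_value_vs_threshold(1)[OF lam\<gamma> r2] r1 le by simp
  qed
  have part2: "optimal_gap 2 lam \<gamma> \<le> 2 * optimal_gap 1 lam \<gamma>" if ge: "?T \<le> ?L"
  proof (cases "lam * (r + 1) \<le> 1")
    case True
    \<comment> \<open>The threshold is at least \<open>1 / (2 * r + 1 - \<gamma>)\<close>, which
      places \<open>lam\<close> in the middle regime.\<close>
    have "r * \<gamma> \<le> r * 1"
      using r1 assms by (intro mult_left_mono) auto
    then have "0 \<le> 4 * r + 2 - 4 * (r * \<gamma>) + \<gamma>\<^sup>2"
      using zero_le_power2[of \<gamma>] by linarith
    also have "\<dots> = ?T * (2 * r + 1 - \<gamma>) - (6 * r + 2 - \<gamma>)"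
      using r2 by (simp add: algebra_simps power2_eq_square)
    finally have "6 * r + 2 - \<gamma> \<le> ?T * (2 * r + 1 - \<gamma>)" by simp
    also have "\<dots> \<le> ?L * (2 * r + 1 - \<gamma>)"
      using ge r1 assms by (intro mult_right_mono) auto
    finally have "(6 * r + 2 - \<gamma>) * 1 \<le> (6 * r + 2 - \<gamma>) * (lam * (2 * r + 1 - \<gamma>))"
      by (simp only: mult_ac mult_1_right mult_1)
    then have "1 \<le> lam * (2 * r + 1 - \<gamma>)"
      using den by (simp only: mult_le_cancel_left_pos)
    then have gap: "optimal_gap 2 lam \<gamma> = \<gamma> * lam * (?T / (r\<^sup>2 * lam))"
      using optimal_gap_2_middle[OF lam\<gamma> r2] True r1 by simp
    show ?thesis
      unfolding optimal_gap_2_vs_1(2)[OF lam\<gamma> gap]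
      using middle_value_vs_threshold(2)[OF lam\<gamma> r2] r1 ge by simp
  next
    case False
    \<comment> \<open>Squaring \<open>1 - 2 * lam \<le> sqrt 2 * lam\<close> yields the quadratic
      hypothesis of the third regime; it also bounds \<open>1 - 2 * lam + 2 * lam^2\<close> by
      \<open>2 * lam\<close>.\<close>
    have "r * lam \<ge> 1 - lam" using False by (simp add: algebra_simps)
    then have "sqrt 2 * lam \<ge> 1 - 2 * lam" by (simp add: r_def algebra_simps)
    then have "(1 - 2 * lam)\<^sup>2 \<le> (sqrt 2 * lam)\<^sup>2"
      using assms by (intro power_mono) auto
    then have large: "2 * lam\<^sup>2 - 4 * lam + 1 \<le> 0"
      by (simp add: power_mult_distrib) (simp add: algebra_simps power2_eq_square)
    have "0 \<le> (1 - 2 * lam) * (\<gamma> * lam)"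
      using assms by simp
    then have "1 - 2 * lam + 2 * lam\<^sup>2 - (1 - 2 * lam) * (\<gamma> * lam) \<le> 2 * lam"
      using large by linarith
    then have "(1 - 2 * lam + 2 * lam\<^sup>2 - (1 - 2 * lam) * (\<gamma> * lam)) / (lam * (1 - lam))
        \<le> 2 * lam / (lam * (1 - lam))"
      using assms by (intro divide_right_mono) auto
    also have "\<dots> = 2 / (1 - lam)" using assms by simp
    finally show ?thesis
      using optimal_gap_2_vs_1(2)[OF lam\<gamma> optimal_gap_2_large[OF lam\<gamma> large]] by simp
  qed
  show ?thesis
    unfolding T pos_le_divide_eq[OF den] pos_divide_le_eq[OF den]
    using part1 part2 by blast
qed

end
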